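(* For any integers $0<m<n$, $$d_{\mathrm{GH}}^{\mathbb Z_2}(\mathbb S^m_{\mathrm E},\mathbb S^n_{\mathrm E})\ \ge\ \frac12\sqrt{\frac{2m+4}{m+1}}.$$
   Context: $\mathbb S^n_{\mathrm E}$ is the unit sphere in $\mathbb R^{n+1}$ with the Euclidean metric $\|u-v\|$ inherited from $\mathbb R^{n+1}$ and the antipodal $\mathbb Z_2$-action $u\mapsto-u$. For metric spaces $X,Y$ with isometric $\mathbb Z_2$-actions generated by involutions $\tau_X,\tau_Y$, $d_{\mathrm{GH}}^{\mathbb Z_2}(X,Y):=\frac12\inf_R\sup_{(x,y),(x',y')\in R}|d_X(x,x')-d_Y(y,y')|$, the infimum over all sets $R\subseteq X\times Y$ projecting onto $X$ and onto $Y$ such that $(\tau_X(x),\tau_Y(y))\in R$ whenever $(x,y)\in R$. *)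

theory Defs
  imports "HOL-Analysis.Analysis"
begin

text \<open>Metric spaces are subsets of types of class \<^class>\<open>metric_space\<close> with the restricted metric;
  a \<open>\<int>\<^sub>2\<close>-action is given by the involution that generates it.\<close>

definition isometric_involution_on :: "'a::metric_space set \<Rightarrow> ('a \<Rightarrow> 'a) \<Rightarrow> bool" where
  "isometric_involution_on X \<tau> \<longleftrightarrow>
     (\<forall>x\<in>X. \<tau> x \<in> X \<and> \<tau> (\<tau> x) = x) \<and> (\<forall>x\<in>X. \<forall>y\<in>X. dist (\<tau> x) (\<tau> y) = dist x y)"

definition Z2_correspondence ::
  "'a set \<Rightarrow> ('a \<Rightarrow> 'a) \<Rightarrow> 'b set \<Rightarrow> ('b \<Rightarrow> 'b) \<Rightarrow> ('a \<times> 'b) set \<Rightarrow> bool" where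
  "Z2_correspondence X \<tau>\<^sub>X Y \<tau>\<^sub>Y R \<longleftrightarrow>
     R \<subseteq> X \<times> Y \<and> fst ` R = X \<and> snd ` R = Y \<and> (\<forall>(x, y)\<in>R. (\<tau>\<^sub>X x, \<tau>\<^sub>Y y) \<in> R)"

text \<open>The values lie in \<^typ>\<open>ennreal\<close>, so that the supremum and the infimum are the true ones
  also for unbounded spaces.\<close>

definition distortion :: "('a::metric_space \<times> 'b::metric_space) set \<Rightarrow> ennreal" where
  "distortion R = (SUP (x, y)\<in>R. SUP (x', y')\<in>R. ennreal \<bar>dist x x' - dist y y'\<bar>)"

definition Z2_GH_dist ::
  "'a::metric_space set \<Rightarrow> ('a \<Rightarrow> 'a) \<Rightarrow> 'b::metric_space set \<Rightarrow> ('b \<Rightarrow> 'b) \<Rightarrow> ennreal" where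
  "Z2_GH_dist X \<tau>\<^sub>X Y \<tau>\<^sub>Y = (INF R\<in>{R. Z2_correspondence X \<tau>\<^sub>X Y \<tau>\<^sub>Y R}. distortion R) / 2"

lemma isometric_involution_on_antipodal:
  "isometric_involution_on (sphere (0::'a::real_normed_vector) r) uminus"
  by (auto simp: isometric_involution_on_def dist_norm norm_minus_commute)

end

theory Submission
  imports Defs "HOL-Homology.Homology"
begin

text \<open>
Put \<open>d = m + 1\<close>. The bound is the edge length \<open>\<surd>(2 + 2 / d)\<close> of the regular simplex inscribed in
\<open>\<S>\<^sup>m \<subseteq> \<real>\<^sup>d\<close>. It suffices that every equivariant correspondence contains, for every
\<open>\<epsilon> > 0\<close>, two pairs whose components in \<open>\<S>\<^sup>n\<close> are \<open>\<epsilon>\<close>-close and whose components in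
\<open>\<S>\<^sup>m\<close> are at least this edge length apart (\<open>Z2_correspondence_discontinuity\<close>); this is a
theorem of Dubins and Schwarz about odd, possibly discontinuous maps, phrased for correspondences.

Suppose it fails. For \<open>y \<in> \<S>\<^sup>n\<close> collect in \<open>F y\<close> all points that correspond to points near
\<open>y\<close>. Any two of them are closer than the edge length, so their inner products exceed \<open>- 1 / d\<close>.
By Caratheodory's theorem a convex combination with value 0 would need only \<open>d + 1\<close> points, and
expanding its squared norm contradicts the Cauchy--Schwarz inequality
(\<open>zero_not_in_hull_of_narrow_set\<close>). A partition of unity selects continuously, and up to a positive
factor, a point of the convex hull of \<open>F y\<close>; made odd, this gives a continuous odd map from
\<open>\<S>\<^sup>n\<close> to \<open>\<real>\<^sup>d\<close> without zeros, against the Borsuk--Ulam theorem (\<open>Borsuk_Ulam_vec\<close>).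

The Borsuk--Ulam theorem is proved with singular chains. A tower on a space with an involution
\<open>\<tau>\<close> imitates the antipodal cell structure of a sphere, with one chain \<open>c\<^sub>k\<close> in each dimension:
\<open>\<partial>c\<^sub>k\<^sub>+\<^sub>1\<close> is the twist \<open>c\<^sub>k \<plusminus> \<tau>c\<^sub>k\<close>, with signs that make \<open>\<partial>\<partial> = 0\<close>. An odd map
\<open>\<S>\<^sup>m\<^sup>+\<^sup>1 \<rightarrow> \<S>\<^sup>m\<close> carries a tower of height \<open>m + 1\<close> to \<open>\<S>\<^sup>m\<close>, where the twist of
\<open>c\<^sub>m\<close> is then a boundary. On \<open>\<S>\<^sup>m\<close> the twists of the top chains of any two towers differ, up
to boundaries, by the twist \<open>w \<plusminus> \<tau>w\<close> of a cycle (\<open>towers_differ_by_twisted_cycle\<close>), which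
is homologous to an even multiple of a cycle because \<open>\<tau>\<close> has degree \<open>\<plusminus>1\<close>
(\<open>even_twist_of_top_cycle\<close>). But induction over the equators gives a tower whose top twist
is not divisible by 2 in homology (\<open>tower_with_odd_top\<close>).
\<close>

section \<open>Twisted chains and reduced cycles\<close>

text \<open>The sign \<open>s\<close> is a parameter because the signs alternate along a tower: composing the twists
with signs \<open>s = \<plusminus>1\<close> and \<open>- s\<close> gives \<open>1 - s\<^sup>2\<tau>\<^sup>2 = 0\<close>.\<close>

definition twist :: "('a \<Rightarrow> 'a) \<Rightarrow> int \<Rightarrow> nat \<Rightarrow> 'a chain \<Rightarrow> 'a chain" where
  "twist \<tau> s p c = c + frag_cmul s (chain_map p \<tau> c)"

lemma twist_add: "twist \<tau> s p (a + b) = twist \<tau> s p a + twist \<tau> s p b"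
  by (simp add: twist_def chain_map_add frag_cmul_distrib2)

lemma twist_diff: "twist \<tau> s p (a - b) = twist \<tau> s p a - twist \<tau> s p b"
  using twist_add[of \<tau> s p "a - b" b] by (simp add: algebra_simps)

lemma singular_chain_twist:
  assumes "continuous_map X X \<tau>" "singular_chain p X c"
  shows "singular_chain p X (twist \<tau> s p c)"
  unfolding twist_def using assms
  by (intro singular_chain_add singular_chain_cmul singular_chain_chain_map)

lemma chain_boundary_twist:
  assumes "singular_chain (Suc p) X c"
  shows "chain_boundary (Suc p) (twist \<tau> s (Suc p) c) = twist \<tau> s p (chain_boundary (Suc p) c)"
  unfolding twist_def
  by (simp add: chain_boundary_add chain_boundary_cmul chain_boundary_chain_map[OF assms])

lemma twist_twist:
  assumes "\<And>x. x \<in> topspace X \<Longrightarrow> \<tau> (\<tau> x) = x" "singular_chain p X c" "s * s = 1"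
  shows "twist \<tau> s p (twist \<tau> (- s) p c) = 0"
proof -
  have "chain_map p \<tau> (chain_map p \<tau> c) = c"
    using chain_map_id_gen[OF assms(2), of "\<tau> \<circ> \<tau>"] assms(1) by (simp add: chain_map_compose)
  then show ?thesis
    by (simp add: twist_def chain_map_add chain_map_cmul chain_map_diff frag_cmul_distrib2 assms(3)
        flip: frag_cmul_distrib)
qed

lemma chain_map_twist:
  assumes "\<And>x. x \<in> topspace X \<Longrightarrow> g (\<tau> x) = \<sigma> (g x)" "singular_chain p X c"
  shows "chain_map p g (twist \<tau> s p c) = twist \<sigma> s p (chain_map p g c)"
proof -
  have "chain_map p (g \<circ> \<tau>) c = chain_map p (\<sigma> \<circ> g) c"
    by (rule chain_map_eq[OF assms(2)]) (simp add: assms(1))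
  then show ?thesis
    by (simp add: twist_def chain_map_add chain_map_cmul chain_map_compose)
qed

text \<open>In dimension 0 the coefficients must sum to 0, which is expressed by mapping the chain to a point.
Reduced homology classifies these cycles, and it vanishes below the top dimension of a sphere also
in degree 0.\<close>

definition reduced_cycle :: "nat \<Rightarrow> 'a topology \<Rightarrow> 'a chain \<Rightarrow> bool" where
  "reduced_cycle p X c \<longleftrightarrow>
     singular_relcycle p X {} c \<and> (p = 0 \<longrightarrow> chain_map 0 (\<lambda>_. ()) c = 0)"

lemma reduced_cycle_diff:
  "reduced_cycle p X a \<Longrightarrow> reduced_cycle p X b \<Longrightarrow> reduced_cycle p X (a - b)"
  by (auto simp: reduced_cycle_def singular_relcycle_diff chain_map_diff)

lemma reduced_cycle_map:
  assumes "continuous_map X Y f" "reduced_cycle p X c"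
  shows "reduced_cycle p Y (chain_map p f c)"
proof -
  have "chain_map 0 (\<lambda>_. ()) (chain_map 0 f c) = chain_map 0 ((\<lambda>_. ()) \<circ> f) c"
    by (simp only: chain_map_compose o_apply)
  then have "p = 0 \<longrightarrow> chain_map 0 (\<lambda>_. ()) (chain_map 0 f c) = 0"
    using assms(2) by (simp add: reduced_cycle_def o_def)
  then show ?thesis
    using assms singular_relcycle_chain_map[of p X "{}" c Y f "{}"] by (auto simp: reduced_cycle_def)
qed

text \<open>This and the next lemma pass from classes in homology groups to chains.\<close>

lemma class_in_reduced_homology_group:
  assumes "reduced_cycle p X c"
  shows "homologous_rel_set p X {} c \<in> carrier (reduced_homology_group (int p) X)"
proof -
  have c: "singular_relcycle p X {} c" using assms by (simp add: reduced_cycle_def)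
  then have H: "homologous_rel_set p X {} c \<in> carrier (homology_group (int p) X)"
    by (auto simp: carrier_relative_homology_group)
  show ?thesis
  proof (cases "p = 0")
    case False then show ?thesis using H by (simp add: un_reduced_homology_group)
  next
    case True
    let ?P = "discrete_topology {()}"
    have "hom_induced (int p) X {} ?P {} (\<lambda>x. ()) (homologous_rel_set p X {} c)
        = homologous_rel_set p ?P {} (chain_map p (\<lambda>x. ()) c)"
      by (rule hom_induced_chain_map) (use c in auto)
    also have "chain_map p (\<lambda>x. ()) c = 0" using assms True by (simp add: reduced_cycle_def)
    also have "homologous_rel_set p ?P {} 0 = \<one>\<^bsub>homology_group (int p) ?P\<^esub>"
      unfolding one_relative_homology_group
      by (simp only: homologous_rel_set_eq_relboundary singular_relboundary_0)
    finally show ?thesis using H by (simp add: carrier_reduced_homology_group kernel_def)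
  qed
qed

lemma reduced_cycle_bounds:
  assumes "trivial_group (reduced_homology_group (int p) X)" "reduced_cycle p X c"
  obtains d where "singular_chain (Suc p) X d" "chain_boundary (Suc p) d = c"
proof -
  have "homologous_rel_set p X {} c = singular_relboundary_set p X {}"
    using class_in_reduced_homology_group[OF assms(2)] assms(1)
    by (auto simp: trivial_group_def one_reduced_homology_group)
  then have "singular_relboundary p X {} c" by (simp only: homologous_rel_set_eq_relboundary)
  then show ?thesis using that by (auto simp: singular_boundary)
qed

section \<open>Towers of chains\<close>

definition point_chain :: "'a \<Rightarrow> 'a chain" where
  "point_chain a = frag_of (restrict (\<lambda>_. a) (standard_simplex 0))"

lemma chain_map_point: "chain_map 0 f (point_chain a) = point_chain (f a)"
  by (simp add: point_chain_def simplex_map_def o_def cong: restrict_cong)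

lemma singular_chain_point: "a \<in> topspace X \<Longrightarrow> singular_chain 0 X (point_chain a)"
  by (simp add: point_chain_def singular_chain_of singular_simplex_def)

lemma reduced_cycle_point_diff:
  assumes "a \<in> topspace X" "b \<in> topspace X"
  shows "reduced_cycle 0 X (point_chain a - point_chain b)"
  using assms
  by (simp add: reduced_cycle_def singular_cycle singular_chain_diff singular_chain_point
      chain_map_diff chain_map_point chain_boundary_def)

text \<open>The equation \<open>\<partial>c\<^sub>k\<^sub>+\<^sub>1 = c\<^sub>k + (-1)\<^sup>k\<^sup>+\<^sup>1 \<tau>c\<^sub>k\<close> is that of the cells of a sphere on
which the antipodal map exchanges the two hemispheres of each dimension.\<close>

definition tower :: "'a topology \<Rightarrow> ('a \<Rightarrow> 'a) \<Rightarrow> nat \<Rightarrow> (nat \<Rightarrow> 'a chain) \<Rightarrow> bool" where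
  "tower X \<tau> n c \<longleftrightarrow>
     (\<exists>a\<in>topspace X. c 0 = point_chain a) \<and> (\<forall>k\<le>n. singular_chain k X (c k)) \<and>
     (\<forall>k<n. chain_boundary (Suc k) (c (Suc k)) = twist \<tau> ((-1) ^ Suc k) k (c k))"

lemma tower_twist_cycle:
  assumes \<tau>: "continuous_map X X \<tau>" "\<And>x. x \<in> topspace X \<Longrightarrow> \<tau> (\<tau> x) = x"
    and c: "tower X \<tau> n c" "k \<le> n"
  shows "reduced_cycle k X (twist \<tau> ((-1) ^ Suc k) k (c k))"
proof (cases k)
  case 0
  obtain a where a: "a \<in> topspace X" "c 0 = point_chain a" using c by (auto simp: tower_def)
  moreover have "\<tau> a \<in> topspace X" using \<tau>(1) a(1) continuous_map_image_subset_topspace by blast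
  ultimately show ?thesis
    using reduced_cycle_point_diff[of a X "\<tau> a"] by (simp add: 0 twist_def chain_map_point)
next
  case (Suc j)
  let ?s = "(-1) ^ Suc k :: int"
  have ck: "singular_chain (Suc j) X (c (Suc j))" and cj: "singular_chain j X (c j)"
    and bd: "chain_boundary (Suc j) (c (Suc j)) = twist \<tau> (- ?s) j (c j)"
    using c Suc by (auto simp: tower_def)
  have "chain_boundary (Suc j) (twist \<tau> ?s (Suc j) (c (Suc j))) = twist \<tau> ?s j (twist \<tau> (- ?s) j (c j))"
    by (simp only: chain_boundary_twist[OF ck] bd)
  also have "\<dots> = 0" by (rule twist_twist[OF \<tau>(2) cj]) (auto simp flip: power_mult_distrib)
  finally show ?thesis using singular_chain_twist[OF \<tau>(1) ck]
    by (simp add: reduced_cycle_def singular_cycle Suc)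
qed

lemma tower_extend:
  assumes "tower X \<tau> n c" "singular_chain (Suc n) X d"
    "chain_boundary (Suc n) d = twist \<tau> ((-1) ^ Suc n) n (c n)"
  shows "tower X \<tau> (Suc n) (c(Suc n := d))"
  using assms by (auto simp: tower_def le_Suc_eq less_Suc_eq)

text \<open>The obstruction to adding one more chain is a reduced homology class in the top dimension
reached, so a tower grows as long as these groups vanish.\<close>

lemma tower_exists:
  assumes \<tau>: "continuous_map X X \<tau>" "\<And>x. x \<in> topspace X \<Longrightarrow> \<tau> (\<tau> x) = x"
    and "topspace X \<noteq> {}"
    and triv: "\<And>k. k < n \<Longrightarrow> trivial_group (reduced_homology_group (int k) X)"
  shows "\<exists>c. tower X \<tau> n c"
  using triv
proof (induction n)
  case 0
  obtain a where "a \<in> topspace X" using assms(3) by blast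
  then have "tower X \<tau> 0 (\<lambda>_. point_chain a)" by (auto simp: tower_def singular_chain_point)
  then show ?case by blast
next
  case (Suc n)
  then obtain c where c: "tower X \<tau> n c" by auto
  obtain d where "singular_chain (Suc n) X d" "chain_boundary (Suc n) d = twist \<tau> ((-1) ^ Suc n) n (c n)"
    using reduced_cycle_bounds[OF Suc.prems[of n] tower_twist_cycle[OF \<tau> c order_refl]] by auto
  then show ?case using tower_extend[OF c] by blast
qed

lemma tower_map:
  assumes g: "continuous_map X Y g" "\<And>x. x \<in> topspace X \<Longrightarrow> g (\<tau> x) = \<sigma> (g x)"
    and c: "tower X \<tau> n c"
  shows "tower Y \<sigma> n (\<lambda>k. chain_map k g (c k))"
  unfolding tower_def
proof (intro conjI allI impI)
  obtain a where "a \<in> topspace X" "c 0 = point_chain a" using c by (auto simp: tower_def)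
  then show "\<exists>b\<in>topspace Y. chain_map 0 g (c 0) = point_chain b"
    using g(1) continuous_map_image_subset_topspace by (fastforce simp: chain_map_point)
next
  fix k assume "k \<le> n"
  then show "singular_chain k Y (chain_map k g (c k))"
    using c g(1) by (auto simp: tower_def intro: singular_chain_chain_map)
next
  fix k assume "k < n"
  then have "singular_chain (Suc k) X (c (Suc k))" "singular_chain k X (c k)"
    "chain_boundary (Suc k) (c (Suc k)) = twist \<tau> ((-1) ^ Suc k) k (c k)"
    using c by (auto simp: tower_def)
  then show "chain_boundary (Suc k) (chain_map (Suc k) g (c (Suc k)))
        = twist \<sigma> ((-1) ^ Suc k) k (chain_map k g (c k))"
    by (simp add: chain_boundary_chain_map chain_map_twist[where X = X and g = g and \<tau> = \<tau> and \<sigma> = \<sigma>, OF g(2)])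
qed

text \<open>This is the usual step-by-step comparison of two resolutions. If the twists differ by the twist of a
cycle \<open>w = \<partial>d\<close> in dimension \<open>k\<close>, then \<open>c\<^sub>k\<^sub>+\<^sub>1 - c'\<^sub>k\<^sub>+\<^sub>1\<close> and the twist of \<open>d\<close> have the same boundary, and
their difference is the next cycle. The twist of \<open>d\<close> has the opposite sign of the next twist and
is therefore annihilated by it.\<close>

lemma towers_differ_by_twisted_cycle:
  assumes \<tau>: "continuous_map X X \<tau>" "\<And>x. x \<in> topspace X \<Longrightarrow> \<tau> (\<tau> x) = x"
    and c: "tower X \<tau> n c" and c': "tower X \<tau> n c'"
    and triv: "\<And>k. k < n \<Longrightarrow> trivial_group (reduced_homology_group (int k) X)"
    and "k \<le> n"
  shows "\<exists>w. reduced_cycle k X w \<and>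
    twist \<tau> ((-1) ^ Suc k) k (c k) - twist \<tau> ((-1) ^ Suc k) k (c' k) = twist \<tau> ((-1) ^ Suc k) k w"
  using \<open>k \<le> n\<close>
proof (induction k)
  case 0
  have "reduced_cycle 0 X (c 0 - c' 0)"
    using c c' reduced_cycle_point_diff by (fastforce simp: tower_def)
  then show ?case using twist_diff by metis
next
  case (Suc k)
  let ?s = "(-1) ^ Suc k :: int"
  obtain w where w: "reduced_cycle k X w"
      "twist \<tau> ?s k (c k) - twist \<tau> ?s k (c' k) = twist \<tau> ?s k w"
    using Suc by auto
  obtain d where d: "singular_chain (Suc k) X d" "chain_boundary (Suc k) d = w"
    using reduced_cycle_bounds[OF triv w(1)] Suc.prems by auto
  define v where "v = c (Suc k) - c' (Suc k) - twist \<tau> ?s (Suc k) d"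
  have sc: "singular_chain (Suc k) X (c (Suc k))" "singular_chain (Suc k) X (c' (Suc k))"
    and bd: "chain_boundary (Suc k) (c (Suc k)) = twist \<tau> ?s k (c k)"
      "chain_boundary (Suc k) (c' (Suc k)) = twist \<tau> ?s k (c' k)"
    using c c' Suc.prems by (auto simp: tower_def)
  have "chain_boundary (Suc k) v = 0"
    unfolding v_def chain_boundary_diff chain_boundary_twist[OF d(1)] d(2) bd w(2) by simp
  moreover have "singular_chain (Suc k) X v"
    unfolding v_def using sc d(1) \<tau>(1) by (intro singular_chain_diff singular_chain_twist)
  ultimately have "reduced_cycle (Suc k) X v" by (simp add: reduced_cycle_def singular_cycle)
  moreover have "twist \<tau> (- ?s) (Suc k) (twist \<tau> (- (- ?s)) (Suc k) d) = 0"
    by (rule twist_twist[OF \<tau>(2) d(1)]) (auto simp flip: power_mult_distrib)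
  then have "twist \<tau> ((-1) ^ Suc (Suc k)) (Suc k) v =
      twist \<tau> ((-1) ^ Suc (Suc k)) (Suc k) (c (Suc k)) - twist \<tau> ((-1) ^ Suc (Suc k)) (Suc k) (c' (Suc k))"
    unfolding v_def twist_diff by simp
  ultimately show ?case by metis
qed

section \<open>Divisibility by two in the homology of spheres\<close>

definition even_cycle :: "nat \<Rightarrow> 'a topology \<Rightarrow> 'a chain \<Rightarrow> bool" where
  "even_cycle p X z \<longleftrightarrow>
     (\<exists>v. singular_relcycle p X {} v \<and> singular_relboundary p X {} (z - frag_cmul 2 v))"

lemma homology_class_eq:
  "homologous_rel_set p X S a = homologous_rel_set p X S b \<longleftrightarrow> singular_relboundary p X S (a - b)"
  by (simp only: homologous_rel_set_eq) (simp only: homologous_rel_def)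

lemma pow_reduced_class:
  assumes "reduced_cycle p X w"
  shows "homologous_rel_set p X {} w [^]\<^bsub>reduced_homology_group (int p) X\<^esub> (d::int)
       = homologous_rel_set p X {} (frag_cmul d w)"
proof -
  let ?C = "relcycle_group p X {}" and ?H = "homology_group (int p) X"
  have w: "singular_relcycle p X {} w" using assms by (simp add: reduced_cycle_def)
  have hom: "homologous_rel_set p X {} \<in> hom ?C ?H"
    using normal.r_coset_hom_Mod[OF normal_subgroup_singular_relboundary_relcycle[of p X "{}"]]
    by (simp add: right_coset_singular_relboundary relative_homology_group_def)
  interpret h: group_hom ?C ?H "homologous_rel_set p X {}"
    using hom by (simp add: group_hom_def group_hom_axioms_def)
  have "w [^]\<^bsub>?C\<^esub> d = frag_cmul d w"
  proof -
    have "w [^]\<^bsub>?C\<^esub> d = w [^]\<^bsub>chain_group p X\<^esub> d"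
      unfolding relcycle_group_def
      by (rule group.int_pow_subgroup_generated) (use w in \<open>auto simp flip: relcycle_group_def\<close>)
    also have "\<dots> = frag_cmul d w"
      unfolding chain_group_def
      by (rule int_pow_free_Abelian_group) (use w in \<open>auto simp: singular_relcycle_def singular_chain_def\<close>)
    finally show ?thesis .
  qed
  moreover have "homologous_rel_set p X {} w [^]\<^bsub>reduced_homology_group (int p) X\<^esub> d
      = homologous_rel_set p X {} w [^]\<^bsub>?H\<^esub> d"
    using class_in_reduced_homology_group[OF assms]
    unfolding reduced_homology_group_def
    by (intro group.int_pow_subgroup_generated) auto
  ultimately show ?thesis using h.hom_int_pow[of w d] w by simp
qed

text \<open>An involution of \<open>\<S>\<^sup>n\<close> has degree \<open>d = \<plusminus>1\<close>, so \<open>w \<plusminus> \<tau>w\<close> is homologous to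
\<open>(1 \<plusminus> d) w\<close>, and \<open>1 \<plusminus> d\<close> is 0 or 2.\<close>

lemma even_twist_of_top_cycle:
  assumes \<tau>: "continuous_map (nsphere n) (nsphere n) \<tau>" "\<And>x. x \<in> topspace (nsphere n) \<Longrightarrow> \<tau> (\<tau> x) = x"
    and w: "reduced_cycle n (nsphere n) w" and s: "s = 1 \<or> s = -1"
  shows "even_cycle n (nsphere n) (twist \<tau> s n w)"
proof -
  let ?d = "Brouwer_degree2 n \<tau>"
  have "homeomorphic_maps (nsphere n) (nsphere n) \<tau> \<tau>"
    using \<tau> by (simp add: homeomorphic_maps_def)
  then have d: "?d = 1 \<or> ?d = -1" by (metis Brouwer_degree2_homeomorphic_maps abs_eq_iff' zero_less_one zero_le_one)
  have c: "singular_relcycle n (nsphere n) {} w" using w by (simp add: reduced_cycle_def)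
  have "homologous_rel_set n (nsphere n) {} (chain_map n \<tau> w)
      = hom_induced (int n) (nsphere n) {} (nsphere n) {} \<tau> (homologous_rel_set n (nsphere n) {} w)"
    by (rule hom_induced_chain_map[symmetric]) (use \<tau> c in auto)
  also have "\<dots> = homologous_rel_set n (nsphere n) {} (frag_cmul ?d w)"
    by (simp only: Brouwer_degree2[OF class_in_reduced_homology_group[OF w]] pow_reduced_class[OF w])
  finally have "singular_relboundary n (nsphere n) {} (chain_map n \<tau> w - frag_cmul ?d w)"
    by (simp only: homology_class_eq)
  then have b: "singular_relboundary n (nsphere n) {} (frag_cmul s (chain_map n \<tau> w - frag_cmul ?d w))"
    by (rule singular_relboundary_cmul)
  obtain k where k: "1 + s * ?d = 2 * k" using s d by (metis (no_types, opaque_lifting) add.right_inverse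
     mult.right_neutral mult_minus_right mult_zero_right one_add_one minus_minus)
  have "twist \<tau> s n w - frag_cmul 2 (frag_cmul k w) = frag_cmul s (chain_map n \<tau> w - frag_cmul ?d w)"
  proof -
    have "frag_cmul 2 (frag_cmul k w) = w + frag_cmul (s * ?d) w"
      by (simp add: k[symmetric] frag_cmul_distrib)
    moreover have "frag_cmul s (chain_map n \<tau> w - frag_cmul ?d w)
       = frag_cmul s (chain_map n \<tau> w) - frag_cmul (s * ?d) w"
      using frag_cmul_distrib2[of s "chain_map n \<tau> w - frag_cmul ?d w" "frag_cmul ?d w"] by (simp add: algebra_simps)
    ultimately show ?thesis by (simp add: twist_def)
  qed
  then show ?thesis unfolding even_cycle_def using b singular_relcycle_cmul[OF c] by metis
qed

text \<open>What injectivity and, in the next lemma, surjectivity of the map induced on homology mean for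
chains.\<close>

lemma relboundary_if_injective:
  assumes f: "continuous_map X Y f" "f \<in> S \<rightarrow> T"
    and inj: "inj_on (hom_induced (int p) X S Y T f) (carrier (relative_homology_group (int p) X S))"
    and c: "singular_relcycle p X S c" "singular_relboundary p Y T (chain_map p f c)"
  shows "singular_relboundary p X S c"
proof -
  have "hom_induced (int p) X S Y T f (homologous_rel_set p X S c)
      = hom_induced (int p) X S Y T f (homologous_rel_set p X S 0)"
    unfolding hom_induced_chain_map[OF f c(1)] hom_induced_chain_map[OF f singular_relcycle_0]
      homology_class_eq using c(2) by simp
  then have "homologous_rel_set p X S c = homologous_rel_set p X S 0"
    by (rule inj_onD[OF inj]) (auto simp: carrier_relative_homology_group c)
  then show ?thesis unfolding homology_class_eq by simp
qed

lemma homologous_lift_if_surjective: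
  assumes f: "continuous_map X Y f" "f \<in> S \<rightarrow> T"
    and surj: "carrier (relative_homology_group (int p) Y T)
      \<subseteq> hom_induced (int p) X S Y T f ` carrier (relative_homology_group (int p) X S)"
    and v: "singular_relcycle p Y T v"
  obtains u where "singular_relcycle p X S u" "singular_relboundary p Y T (v - chain_map p f u)"
proof -
  have "homologous_rel_set p Y T v \<in> hom_induced (int p) X S Y T f ` carrier (relative_homology_group (int p) X S)"
    using surj v by (auto simp: carrier_relative_homology_group)
  then obtain u where u: "singular_relcycle p X S u"
    "homologous_rel_set p Y T v = hom_induced (int p) X S Y T f (homologous_rel_set p X S u)"
    by (auto simp: carrier_relative_homology_group)
  show ?thesis using that[OF u(1)] u(2)
    unfolding hom_induced_chain_map[OF f u(1)] homology_class_eq .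
qed

section \<open>The Borsuk--Ulam theorem for singular chains\<close>

definition antipode :: "(nat \<Rightarrow> real) \<Rightarrow> nat \<Rightarrow> real" where
  "antipode x = (\<lambda>i. - x i)"

lemma antipode_antipode [simp]: "antipode (antipode x) = x"
  by (simp add: antipode_def)

lemma continuous_map_antipode: "continuous_map (nsphere n) (nsphere n) antipode"
proof -
  have "continuous_map (nsphere n) (powertop_real UNIV) antipode"
    unfolding continuous_map_componentwise_UNIV antipode_def
    by (intro allI continuous_map_minus continuous_map_nsphere_projection)
  moreover have "antipode x \<in> topspace (nsphere n)" if "x \<in> topspace (nsphere n)" for x
    using that by (auto simp: nsphere antipode_def)
  ultimately show ?thesis
    by (auto simp: nsphere continuous_map_in_subtopology)
qed

lemma equator_of_hemisphere:
  "subtopology (subtopology (nsphere (Suc m)) {x. x (Suc m) \<ge> 0}) {x. x (Suc m) = 0} = nsphere m"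
proof -
  have "{x::nat\<Rightarrow>real. x (Suc m) \<ge> 0} \<inter> {x. x (Suc m) = 0} = {x. x (Suc m) = 0}" by auto
  then show ?thesis by (simp add: subtopology_subtopology subtopology_nsphere_equator)
qed

text \<open>The isomorphism behind this is, in reduced homology, that of \<open>H\<^sub>m\<^sub>+\<^sub>1(\<S>\<^sup>m\<^sup>+\<^sup>1)\<close> with \<open>H\<^sub>m(\<S>\<^sup>m)\<close>. Relative to the
lower hemisphere \<open>D\<close>, the chain \<open>c \<plusminus> \<tau>c\<close> is just \<open>c\<close>, since \<open>\<tau>c\<close> lies in \<open>D\<close>. By
excision, being even relative to \<open>D\<close> is the same as being even in the upper hemisphere relative to
the equator, and the boundary operator carries this to the equator.\<close>

lemma even_cycle_on_equator:
  fixes m :: nat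
  defines "U \<equiv> subtopology (nsphere (Suc m)) {x. x (Suc m) \<ge> 0}"
  assumes c: "singular_chain (Suc m) U c"
    and z: "singular_chain m (nsphere m) (chain_boundary (Suc m) c)"
    and ev: "even_cycle (Suc m) (nsphere (Suc m)) (twist antipode s (Suc m) c)"
  shows "even_cycle m (nsphere m) (chain_boundary (Suc m) c)"
proof -
  let ?S = "nsphere (Suc m)" and ?E = "{x::nat\<Rightarrow>real. x (Suc m) = 0}" and ?D = "{x::nat\<Rightarrow>real. x (Suc m) \<le> 0}"
  have equator: "subtopology U ?E = nsphere m" unfolding U_def by (rule equator_of_hemisphere)
  have id: "continuous_map U ?S id" "id \<in> ?E \<rightarrow> ?D" by (auto simp: U_def)
  have bij: "bij_betw (hom_induced (int (Suc m)) U ?E ?S ?D id)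
      (carrier (relative_homology_group (int (Suc m)) U ?E)) (carrier (relative_homology_group (int (Suc m)) ?S ?D))"
    using iso_relative_homology_group_upper_hemisphere[of "int (Suc m)" "Suc m" "Suc m"]
    unfolding U_def iso_def mem_Collect_eq by (rule conjunct2)
  obtain v where v: "singular_relcycle (Suc m) ?S {} v"
    and b: "singular_relboundary (Suc m) ?S {} (twist antipode s (Suc m) c - frag_cmul 2 v)"
    using ev by (auto simp: even_cycle_def)
  have vD: "singular_relcycle (Suc m) ?S ?D v" using v
    unfolding singular_cycle by (simp add: singular_relcycle)
  obtain u where u: "singular_relcycle (Suc m) U ?E u"
    and vu: "singular_relboundary (Suc m) ?S ?D (v - chain_map (Suc m) id u)"
    using homologous_lift_if_surjective[OF id _ vD] bij_betw_imp_surj_on[OF bij] by blast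
  have cu: "singular_relcycle (Suc m) U ?E (c - frag_cmul 2 u)"
    using c z u by (intro singular_relcycle_diff singular_relcycle_cmul) (auto simp: singular_relcycle equator)
  \<comment> \<open>the antipodal copy of c lives in the lower hemisphere and vanishes relative to it\<close>
  have low: "singular_chain (Suc m) (subtopology ?S ?D) (chain_map (Suc m) antipode c)"
  proof (rule singular_chain_chain_map[OF c])
    show "continuous_map U (subtopology ?S ?D) antipode"
      using continuous_map_antipode[of "Suc m"]
      by (auto simp: U_def continuous_map_in_subtopology continuous_map_from_subtopology antipode_def)
  qed
  have "singular_relboundary (Suc m) ?S ?D
      ((twist antipode s (Suc m) c - frag_cmul 2 v) + (frag_cmul 2 (v - chain_map (Suc m) id u)
        - frag_cmul s (chain_map (Suc m) antipode c)))"
  proof (rule singular_relboundary_add)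
    show "singular_relboundary (Suc m) ?S ?D (twist antipode s (Suc m) c - frag_cmul 2 v)"
      using b unfolding singular_boundary by (auto simp: singular_relboundary_def)
  qed (intro singular_relboundary_diff singular_relboundary_cmul vu singular_chain_imp_relboundary
      singular_chain_cmul low)
  also have "(twist antipode s (Suc m) c - frag_cmul 2 v) + (frag_cmul 2 (v - chain_map (Suc m) id u)
        - frag_cmul s (chain_map (Suc m) antipode c)) = c - frag_cmul 2 u"
  proof -
    have "chain_map (Suc m) id u = u" using u by (intro chain_map_ident) (auto simp: singular_relcycle_def)
    moreover have "frag_cmul 2 v = frag_cmul 2 (v - u) + frag_cmul 2 u"
      by (simp flip: frag_cmul_distrib2)
    ultimately show ?thesis by (simp add: twist_def)
  qed
  finally have "singular_relboundary (Suc m) ?S ?D (chain_map (Suc m) id (c - frag_cmul 2 u))"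
    using cu chain_map_ident[of "Suc m" U "c - frag_cmul 2 u"] by (simp add: singular_relcycle_def)
  then have "singular_relboundary (Suc m) U ?E (c - frag_cmul 2 u)"
    by (rule relboundary_if_injective[OF id bij_betw_imp_inj_on[OF bij] cu])
  then obtain d e where d: "singular_chain (Suc (Suc m)) U d" and e: "singular_chain (Suc m) (nsphere m) e"
    and de: "chain_boundary (Suc (Suc m)) d + e = c - frag_cmul 2 u"
    by (auto simp: singular_relboundary equator)
  have "chain_boundary (Suc m) (chain_boundary (Suc (Suc m)) d) = 0"
    using chain_boundary_boundary_alt[OF d] by simp
  then have "chain_boundary (Suc m) c - frag_cmul 2 (chain_boundary (Suc m) u) = chain_boundary (Suc m) e"
    using arg_cong[OF de, of "chain_boundary (Suc m)"]
    by (simp add: chain_boundary_add chain_boundary_diff chain_boundary_cmul)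
  moreover have "singular_relcycle m (nsphere m) {} (chain_boundary (Suc m) u)"
    using u chain_boundary_boundary_alt[of m U u] by (auto simp: singular_relcycle equator chain_boundary_boundary_alt singular_cycle)
  ultimately show ?thesis using e unfolding even_cycle_def singular_boundary by metis
qed

lemma tower_mono:
  assumes "tower (subtopology X S) \<tau> n c"
  shows "tower X \<tau> n c"
  using assms unfolding tower_def
  by (auto simp: singular_chain_subtopology)

text \<open>The sphere \<open>\<S>\<^sup>0\<close> is a discrete pair of points and simplices are connected.\<close>

lemma singular_simplex_nsphere_0_const:
  assumes \<sigma>: "singular_simplex p (nsphere 0) \<sigma>" and xy: "x \<in> standard_simplex p" "y \<in> standard_simplex p"
  shows "\<sigma> x = \<sigma> y"
proof -
  let ?D = "subtopology (powertop_real UNIV) (standard_simplex p)" and ?h = "(\<lambda>u. u (0::nat)) \<circ> \<sigma>"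
  have cont: "continuous_map ?D (nsphere 0) \<sigma>" using \<sigma> by (simp add: singular_simplex_def)
  have im: "\<sigma> u \<in> topspace (nsphere 0)" if "u \<in> standard_simplex p" for u
    using continuous_map_image_subset_topspace[OF cont] that by auto
  have "continuous_map ?D euclideanreal ?h"
    by (rule continuous_map_compose[OF cont continuous_map_nsphere_projection])
  moreover have "connectedin ?D (standard_simplex p)"
    by (simp add: connectedin_subtopology connectedin_standard_simplex)
  ultimately have "connected (?h ` standard_simplex p)"
    using connectedin_continuous_map_image connectedin_iff_connected by blast
  moreover have "?h ` standard_simplex p \<subseteq> {1, -1}"
    using im by (auto simp: nsphere power2_eq_1_iff)
  then have "finite (?h ` standard_simplex p)" by (rule finite_subset) simp
  ultimately obtain t where "?h ` standard_simplex p = {t}"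
    using xy connected_finite_iff_sing by blast
  then have "\<sigma> x 0 = \<sigma> y 0" using xy by (metis (no_types, lifting) imageI o_apply singletonD)
  moreover have "\<sigma> x i = \<sigma> y i" if "i > 0" for i using im[OF xy(1)] im[OF xy(2)] that by (simp add: nsphere)
  ultimately show ?thesis by (metis ext gr0I)
qed

text \<open>Each step caps the twist of the top chain, a cycle on the equator, by a chain in the contractible
upper hemisphere; \<open>even_cycle_on_equator\<close> transports oddness to the new top twist.\<close>

lemma tower_with_odd_top:
  "\<exists>c. tower (nsphere n) antipode n c \<and>
       \<not> even_cycle n (nsphere n) (twist antipode ((-1) ^ Suc n) n (c n))"
proof (induction n)
  case 0
  let ?a = "\<lambda>i::nat. if i = 0 then 1 else 0 :: real"
  let ?f = "\<lambda>x. restrict (\<lambda>_::nat\<Rightarrow>real. x::nat\<Rightarrow>real) (standard_simplex 0)"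
  let ?S = "nsphere 0"
  have a: "?a \<in> topspace ?S" by (rule in_topspace_nsphere)
  have "\<not> even_cycle 0 ?S (point_chain ?a - point_chain (antipode ?a))"
  proof
    assume "even_cycle 0 ?S (point_chain ?a - point_chain (antipode ?a))"
    then obtain v d where d: "singular_chain 1 ?S d"
      and bd: "chain_boundary 1 d = point_chain ?a - point_chain (antipode ?a) - frag_cmul 2 v"
      by (auto simp: even_cycle_def singular_boundary)
    \<comment> \<open>the coefficient of a point of \<open>\<S>\<^sup>0\<close> vanishes on boundaries, because 1-simplices are constant\<close>
    have "Poly_Mapping.lookup (chain_boundary 1 d) (?f ?a) = 0"
      using d unfolding singular_chain_def
    proof (induction d rule: frag_induction)
      case (one \<sigma>)
      have "singular_face 1 0 \<sigma> = singular_face 1 1 \<sigma>"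
        using one singular_simplex_nsphere_0_const[of 1 \<sigma>]
        by (auto simp: singular_face_def simplical_face_in_standard_simplex restrict_def)
      then show ?case by (simp add: chain_boundary_of)
    qed (auto simp: chain_boundary_diff lookup_minus)
    moreover have "?f ?a \<noteq> ?f (antipode ?a)"
    proof
      assume eq: "?f ?a = ?f (antipode ?a)"
      show False using fun_cong[OF fun_cong[OF eq, of ?a], of 0] by (simp add: antipode_def)
    qed
    ultimately have "0 = 1 - 2 * Poly_Mapping.lookup v (?f ?a)"
      unfolding bd by (simp add: point_chain_def lookup_minus)
    then show False by presburger
  qed
  moreover have "tower ?S antipode 0 (\<lambda>_. point_chain ?a)" using a by (auto simp: tower_def singular_chain_point)
  ultimately show ?case by (intro exI[of _ "\<lambda>_. point_chain ?a"]) (simp add: twist_def chain_map_point)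
next
  case (Suc n)
  let ?U = "subtopology (nsphere (Suc n)) {x. x (Suc n) \<ge> 0}" and ?s = "(-1) ^ Suc n :: int"
  obtain c where c: "tower (nsphere n) antipode n c" "\<not> even_cycle n (nsphere n) (twist antipode ?s n (c n))"
    using Suc by auto
  have cyc: "reduced_cycle n (nsphere n) (twist antipode ?s n (c n))"
    by (rule tower_twist_cycle[OF continuous_map_antipode _ c(1)]) auto
  have incl: "continuous_map (nsphere n) ?U id"
    by (metis equator_of_hemisphere continuous_map_id_subt)
  have "reduced_cycle n ?U (twist antipode ?s n (c n))"
    using reduced_cycle_map[OF incl cyc] cyc chain_map_ident by (metis reduced_cycle_def singular_cycle)
  then obtain d where d: "singular_chain (Suc n) ?U d" "chain_boundary (Suc n) d = twist antipode ?s n (c n)"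
    using reduced_cycle_bounds[OF trivial_reduced_homology_group_contractible_space[OF contractible_space_upper_hemisphere]]
    by (metis order_refl)
  have "tower (nsphere (Suc n)) antipode n c"
    using c(1) tower_mono by (metis subtopology_nsphere_equator)
  then have "tower (nsphere (Suc n)) antipode (Suc n) (c(Suc n := d))"
    using d by (intro tower_extend) (auto simp: singular_chain_subtopology)
  moreover have "\<not> even_cycle (Suc n) (nsphere (Suc n)) (twist antipode t (Suc n) d)" for t
    using even_cycle_on_equator[OF d(1)] d(2) c(2) cyc by (auto simp: reduced_cycle_def singular_cycle)
  ultimately show ?case by (metis fun_upd_same)
qed

text \<open>The tower of height \<open>n + 1\<close> on the larger sphere exists since its homology vanishes below the
top dimension. Its image makes the top twist on the smaller sphere a boundary, so every other
top twist there would be even.\<close>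

theorem no_odd_map_to_lower_nsphere:
  assumes g: "continuous_map (nsphere (Suc n)) (nsphere n) g"
    and odd: "\<And>x. x \<in> topspace (nsphere (Suc n)) \<Longrightarrow> g (antipode x) = antipode (g x)"
  shows False
proof -
  let ?s = "(-1) ^ Suc n :: int"
  have inv: "\<And>x. antipode (antipode x) = x" by simp
  have triv: "trivial_group (reduced_homology_group (int k) (nsphere j))" if "k < j" for k j
    using that by (intro reduced_homology_group_nsphere(2)) simp
  obtain b where b: "tower (nsphere (Suc n)) antipode (Suc n) b"
    using tower_exists[OF continuous_map_antipode inv, of "Suc n" "Suc n"] triv in_topspace_nsphere by fastforce
  define c where "c = (\<lambda>k. chain_map k g (b k))"
  have c: "tower (nsphere n) antipode (Suc n) c"
    unfolding c_def by (rule tower_map[OF g _ b]) (rule odd)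
  obtain c' where c': "tower (nsphere n) antipode n c'"
    "\<not> even_cycle n (nsphere n) (twist antipode ?s n (c' n))" using tower_with_odd_top by blast
  have "tower (nsphere n) antipode n c" using c by (auto simp: tower_def)
  then obtain w where w: "reduced_cycle n (nsphere n) w"
    "twist antipode ?s n (c' n) - twist antipode ?s n (c n) = twist antipode ?s n w"
    using towers_differ_by_twisted_cycle[OF continuous_map_antipode inv c'(1) _ triv order_refl, of c] by blast
  have "?s = 1 \<or> ?s = -1" by (metis power_minus1_even power_minus1_odd evenE oddE add.commute plus_1_eq_Suc)
  then have "even_cycle n (nsphere n) (twist antipode ?s n w)"
    by (intro even_twist_of_top_cycle[OF continuous_map_antipode _ w(1)]) auto
  then obtain v where v: "singular_relcycle n (nsphere n) {} v"
    "singular_relboundary n (nsphere n) {} (twist antipode ?s n w - frag_cmul 2 v)"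
    by (auto simp: even_cycle_def)
  have "singular_relboundary n (nsphere n) {} (twist antipode ?s n (c n))"
    using c by (auto simp: tower_def singular_boundary)
  then have "singular_relboundary n (nsphere n) {}
      (twist antipode ?s n (c n) + (twist antipode ?s n w - frag_cmul 2 v))"
    using v(2) by (rule singular_relboundary_add)
  also have "twist antipode ?s n (c n) + (twist antipode ?s n w - frag_cmul 2 v)
      = twist antipode ?s n (c' n) - frag_cmul 2 v"
    using arg_cong[OF w(2), of "\<lambda>t. twist antipode ?s n (c n) + t - frag_cmul 2 v"] by simp
  finally show False using c'(2) v(1) by (auto simp: even_cycle_def)
qed

section \<open>The Borsuk--Ulam theorem in coordinate spaces\<close>

lemma Borsuk_Ulam_vec:
  fixes g :: "real ^ 'b \<Rightarrow> real ^ 'a"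
  assumes card: "CARD('a::finite) < CARD('b::finite)"
    and cont: "continuous_on (sphere 0 1) g"
    and odd: "\<And>y. y \<in> sphere 0 1 \<Longrightarrow> g (- y) = - g y"
  shows "\<exists>y\<in>sphere 0 1. g y = 0"
proof (rule ccontr)
  assume "\<not> ?thesis"
  then have nz: "g y \<noteq> 0" if "y \<in> sphere 0 1" for y using that by blast
  define m where "m = CARD('a) - 1"
  have m: "CARD('a) = Suc m" by (simp add: m_def)
  obtain ia :: "nat \<Rightarrow> 'a" where ia: "bij_betw ia {..m} UNIV"
    using ex_bij_betw_nat_finite[of "UNIV :: 'a set"] by (auto simp: m atLeast0LessThan lessThan_Suc_atMost)
  obtain ib :: "'b \<Rightarrow> nat" where ib: "bij_betw ib UNIV {..<CARD('b)}"
    using ex_bij_betw_finite_nat[of "UNIV :: 'b set"] by (auto simp: atLeast0LessThan)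
  \<comment> \<open>e embeds \<open>\<S>\<^sup>m\<^sup>+\<^sup>1\<close> into the sphere of \<open>\<real>\<^sup>b\<close>, whose dimension may be larger; r only renames coordinates\<close>
  define e :: "(nat \<Rightarrow> real) \<Rightarrow> real ^ 'b" where "e = (\<lambda>x. \<chi> j. x (ib j))"
  define r :: "real ^ 'a \<Rightarrow> nat \<Rightarrow> real" where "r = (\<lambda>y i. if i \<le> m then y $ ia i else 0)"
  let ?S = "topspace (nsphere (Suc m))"
  have e_sphere: "e x \<in> sphere 0 1" if "x \<in> ?S" for x
  proof -
    have "(\<Sum>j\<in>UNIV. (x (ib j))\<^sup>2) = (\<Sum>i<CARD('b). (x i)\<^sup>2)"
      using sum.reindex_bij_betw[OF ib, of "\<lambda>i. (x i)\<^sup>2"] .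
    also have "\<dots> = (\<Sum>i\<le>Suc m. (x i)\<^sup>2)"
      using that card by (intro sum.mono_neutral_right) (auto simp: nsphere m)
    also have "\<dots> = 1" using that by (simp add: nsphere)
    finally show ?thesis by (simp add: e_def norm_vec_def L2_set_def)
  qed
  have e_cont: "continuous_on ?S e"
    unfolding e_def by (intro continuous_on_vec_lambda continuous_on_subset[OF continuous_on_product_coordinates] subset_UNIV)
  have r_sphere: "r y \<in> topspace (nsphere m)" if "y \<in> sphere 0 1" for y
  proof -
    have "(\<Sum>i\<le>m. (r y i)\<^sup>2) = (\<Sum>j\<in>UNIV. (y $ j)\<^sup>2)"
      using sum.reindex_bij_betw[OF ia, of "\<lambda>j. (y $ j)\<^sup>2"] by (simp add: r_def)
    then show ?thesis using that by (simp add: nsphere r_def norm_vec_def L2_set_def)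
  qed
  define h where "h = (\<lambda>x. r (g (e x) /\<^sub>R norm (g (e x))))"
  have unit: "g (e x) /\<^sub>R norm (g (e x)) \<in> sphere 0 1" if "x \<in> ?S" for x
    using nz[OF e_sphere[OF that]] by simp
  have ge: "continuous_on ?S (\<lambda>x. g (e x))"
    by (rule continuous_on_compose2[OF cont e_cont]) (use e_sphere in auto)
  have "continuous_on ?S h"
    unfolding h_def r_def
  proof (rule continuous_on_coordinatewise_then_product)
    fix i
    show "continuous_on ?S (\<lambda>x. if i \<le> m then (g (e x) /\<^sub>R norm (g (e x))) $ ia i else 0)"
      using nz e_sphere by (cases "i \<le> m") (auto intro!: continuous_intros ge)
  qed
  then have "continuous_map (nsphere (Suc m)) (nsphere m) h"
    using r_sphere[OF unit] unfolding nsphere[of m] continuous_map_in_subtopology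
    by (auto simp: h_def nsphere euclidean_product_topology)
  moreover have "h (antipode x) = antipode (h x)" if "x \<in> ?S" for x
  proof -
    have "e (antipode x) = - e x" by (simp add: e_def antipode_def vec_eq_iff)
    then show ?thesis using odd[OF e_sphere[OF that]] by (auto simp: h_def r_def antipode_def)
  qed
  ultimately show False by (rule no_odd_map_to_lower_nsphere)
qed

section \<open>Narrow sets on the sphere\<close>

text \<open>The bound is sharp: the vertices of a regular simplex have mutual squared distance
\<open>2 + 2 / d\<close> and barycentre 0. If \<open>\<Sum> u\<^sub>x x = 0\<close> with weights of sum 1, then
\<open>\<Sum> u\<^sub>x u\<^sub>y (\<langle>x, y\<rangle> + 1 / d) = 1 / d\<close>. All terms are nonnegative and the diagonal ones add up to
\<open>(1 + 1 / d) \<Sum> u\<^sub>x\<^sup>2\<close>, which is at least \<open>1 / d\<close> by the Cauchy--Schwarz inequality for at most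
\<open>d + 1\<close> weights. Since two weights are positive, some term off the diagonal is positive as well.\<close>

lemma zero_not_in_hull_of_narrow_set:
  fixes F :: "'a::euclidean_space set"
  assumes F: "F \<subseteq> sphere 0 1"
    and narrow: "\<And>x y. x \<in> F \<Longrightarrow> y \<in> F \<Longrightarrow> (dist x y)\<^sup>2 < 2 + 2 / DIM('a)"
  shows "0 \<notin> convex hull F"
proof
  let ?d = "real DIM('a)"
  assume "0 \<in> convex hull F"
  then obtain S u where S: "finite S" "S \<subseteq> F" "card S \<le> DIM('a) + 1" "\<And>x. x \<in> S \<Longrightarrow> 0 \<le> u x" "sum u S = 1"
    and zero: "(\<Sum>v\<in>S. u v *\<^sub>R v) = 0"
    unfolding convex_hull_caratheodory by auto
  have inner_bound: "0 < x \<bullet> y + 1 / ?d" if "x \<in> S" "y \<in> S" for x y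
  proof -
    have "x \<bullet> x = 1" "y \<bullet> y = 1" using that S(2) F by (auto simp: power2_norm_eq_inner[symmetric])
    then have "(dist x y)\<^sup>2 = 2 - 2 * (x \<bullet> y)"
      by (simp add: dist_norm power2_norm_eq_inner inner_diff inner_commute)
    then have "2 - 2 * (x \<bullet> y) < 2 + 2 / ?d" using narrow[of x y] that S(2) by auto
    moreover have "2 / ?d = 2 * (1 / ?d)" by simp
    ultimately show ?thesis by linarith
  qed
  obtain p where p: "p \<in> S" "u p > 0"
    using S(4,5) by (metis less_eq_real_def sum.neutral zero_neq_one)
  have slack: "0 \<le> u x * u y * (x \<bullet> y + 1 / ?d)" if "x \<in> S" "y \<in> S" for x y
    using inner_bound[OF that] S(4)[OF that(1)] S(4)[OF that(2)] by (intro mult_nonneg_nonneg) linarith+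
  have sq: "x \<bullet> x = 1" if "x \<in> S" for x using that S(2) F by (auto simp: power2_norm_eq_inner[symmetric])
  have gram: "(\<Sum>x\<in>S. \<Sum>y\<in>S. u x * u y * (x \<bullet> y)) = 0"
  proof -
    have "(\<Sum>x\<in>S. \<Sum>y\<in>S. u x * u y * (x \<bullet> y)) = (\<Sum>x\<in>S. (u x *\<^sub>R x) \<bullet> (\<Sum>y\<in>S. u y *\<^sub>R y))"
      by (simp add: inner_sum_right sum_distrib_left mult_ac)
    then show ?thesis by (simp add: zero)
  qed
  have total: "(\<Sum>x\<in>S. \<Sum>y\<in>S. u x * u y * (x \<bullet> y + 1 / ?d)) = 1 / ?d"
  proof -
    have "(\<Sum>x\<in>S. \<Sum>y\<in>S. u x * u y * (1 / ?d)) = sum u S * sum u S * (1 / ?d)"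
      by (simp add: sum_product sum_divide_distrib)
    then show ?thesis unfolding distrib_left sum.distrib gram S(5) by simp
  qed
  have diagonal: "(\<Sum>x\<in>S. (u x)\<^sup>2) * (1 + 1 / ?d) < (\<Sum>x\<in>S. \<Sum>y\<in>S. u x * u y * (x \<bullet> y + 1 / ?d))"
  proof -
    have "\<exists>q\<in>S. q \<noteq> p \<and> u q > 0"
    proof (rule ccontr)
      assume "\<not> ?thesis"
      then have "\<And>q. q \<in> S - {p} \<Longrightarrow> u q = 0" using S(4) by fastforce
      then have "(\<Sum>v\<in>S. u v *\<^sub>R v) = u p *\<^sub>R p" using S(1) p(1) by (simp add: sum.remove)
      then have "p = 0" using zero p by simp
      then show False using sq[OF p(1)] by simp
    qed
    then obtain q where q: "q \<in> S" "q \<noteq> p" "u q > 0" by blast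
    have "(u x)\<^sup>2 * (1 + 1 / ?d) \<le> (\<Sum>y\<in>S. u x * u y * (x \<bullet> y + 1 / ?d))" if "x \<in> S" for x
      using member_le_sum[of x S "\<lambda>y. u x * u y * (x \<bullet> y + 1 / ?d)"] slack that S(1) sq[OF that]
      by (simp add: power2_eq_square)
    moreover have "(u p)\<^sup>2 * (1 + 1 / ?d) < (\<Sum>y\<in>S. u p * u y * (p \<bullet> y + 1 / ?d))"
    proof -
      have "0 < u p * u q * (p \<bullet> q + 1 / ?d)"
        using inner_bound[OF p(1) q(1)] p(2) q(3) by (intro mult_pos_pos)
      also have "\<dots> \<le> (\<Sum>y\<in>S - {p}. u p * u y * (p \<bullet> y + 1 / ?d))"
        using member_le_sum[of q "S - {p}" "\<lambda>y. u p * u y * (p \<bullet> y + 1 / ?d)"] slack p q S(1) by auto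
      finally show ?thesis using sq[OF p(1)] by (simp add: sum.remove[OF S(1) p(1)] power2_eq_square)
    qed
    ultimately show ?thesis unfolding sum_distrib_right using S(1) p(1) by (intro sum_strict_mono_ex1) auto
  qed
  have "1 = (sum u S)\<^sup>2" by (simp add: S(5))
  also have "\<dots> \<le> real (card S) * (\<Sum>x\<in>S. (u x)\<^sup>2)"
    using Cauchy_Schwarz_ineq_sum[of "\<lambda>_. 1" u S] by simp
  also have "\<dots> \<le> (?d + 1) * (\<Sum>x\<in>S. (u x)\<^sup>2)"
    using S(3) by (intro mult_right_mono sum_nonneg) auto
  also have "\<dots> = ?d * ((\<Sum>x\<in>S. (u x)\<^sup>2) * (1 + 1 / ?d))" by (simp add: field_simps)
  also have "\<dots> < ?d * (1 / ?d)" using diagonal total by (intro mult_strict_left_mono) auto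
  finally show False by simp
qed

text \<open>Dividing by the total weight makes the combination convex. Points of weight 0 need not belong
to the set, which suits partitions of unity.\<close>

lemma zero_in_convex_if_conic_zero:
  assumes "convex C" "finite I" "\<And>i. i \<in> I \<Longrightarrow> 0 \<le> u i" "\<And>i. i \<in> I \<Longrightarrow> u i \<noteq> 0 \<Longrightarrow> x i \<in> C"
    "k \<in> I" "u k > 0" "(\<Sum>i\<in>I. u i *\<^sub>R x i) = 0"
  shows "0 \<in> C"
proof -
  let ?J = "{i\<in>I. u i \<noteq> 0}" and ?t = "\<Sum>i\<in>I. u i"
  have t: "?t > 0" using assms(2,3,5,6) by (intro sum_pos2[of I k])
  have "(\<Sum>i\<in>?J. (u i / ?t) *\<^sub>R x i) \<in> C"
  proof (rule convex_sum)
    have "sum u ?J = ?t" using assms(2) by (intro sum.mono_neutral_left) auto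
    then show "(\<Sum>i\<in>?J. u i / ?t) = 1" unfolding sum_divide_distrib[symmetric] using t by simp
    show "0 \<le> u i / ?t" "x i \<in> C" if "i \<in> ?J" for i
      using that t assms(3,4) by auto
  qed (use assms(1,2) in auto)
  also have "(\<Sum>i\<in>?J. (u i / ?t) *\<^sub>R x i) = (\<Sum>i\<in>I. (u i / ?t) *\<^sub>R x i)"
    using assms(2) by (intro sum.mono_neutral_left) auto
  also have "\<dots> = (1 / ?t) *\<^sub>R (\<Sum>i\<in>I. u i *\<^sub>R x i)" by (simp add: scaleR_sum_right)
  finally show ?thesis using assms(7) by simp
qed

section \<open>Correspondences between spheres are discontinuous\<close>

text \<open>The symmetry of the correspondence replaces the oddness of a map: with \<open>(x, y)\<close> it contains
\<open>(- x, - y)\<close>, which makes the difference \<open>g\<close> of two averages still point into the cone over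
\<open>F y\<close>.\<close>

lemma Z2_correspondence_discontinuity:
  fixes R :: "((real ^ 'a) \<times> (real ^ 'b)) set"
  assumes card: "CARD('a::finite) < CARD('b::finite)"
    and R: "Z2_correspondence (sphere 0 1) uminus (sphere 0 1) uminus R"
    and "0 < \<epsilon>"
  shows "\<exists>x y x' y'. (x, y) \<in> R \<and> (x', y') \<in> R \<and> dist y y' < \<epsilon> \<and> 2 + 2 / CARD('a) \<le> (dist x x')\<^sup>2"
proof (rule ccontr)
  assume "\<not> ?thesis"
  then have close: "(dist x x')\<^sup>2 < 2 + 2 / CARD('a)" if "(x, y) \<in> R" "(x', y') \<in> R" "dist y y' < \<epsilon>" for x y x' y'
    using that by (meson not_less)
  have R_sub: "R \<subseteq> sphere 0 1 \<times> sphere 0 1" and R_snd: "snd ` R = sphere 0 1"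
    and R_minus: "\<And>x y. (x, y) \<in> R \<Longrightarrow> (- x, - y) \<in> R"
    using R by (auto simp: Z2_correspondence_def)
  define F where "F y = {x. \<exists>y'. (x, y') \<in> R \<and> dist y y' < \<epsilon> / 2}" for y
  have F: "0 \<notin> convex hull F y" for y
  proof (rule zero_not_in_hull_of_narrow_set)
    show "F y \<subseteq> sphere 0 1" using R_sub by (auto simp: F_def)
    show "(dist x x')\<^sup>2 < 2 + 2 / DIM(real ^ 'a)" if x: "x \<in> F y" "x' \<in> F y" for x x'
    proof -
      obtain z z' where "(x, z) \<in> R" "dist y z < \<epsilon> / 2" "(x', z') \<in> R" "dist y z' < \<epsilon> / 2"
        using x by (auto simp: F_def)
      moreover from this have "dist z z' < \<epsilon>"
        using dist_triangle_half_r[of y z \<epsilon> z'] by simp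
      ultimately show ?thesis using close by simp
    qed
  qed
  obtain K where K: "K \<subseteq> sphere (0 :: real ^ 'b) 1" "finite K" "sphere 0 1 \<subseteq> (\<Union>k\<in>K. ball k (\<epsilon> / 2))"
    by (rule compactE_image[of "sphere (0 :: real ^ 'b) 1" "sphere 0 1" "\<lambda>k. ball k (\<epsilon> / 2)"])
      (use \<open>0 < \<epsilon>\<close> in auto)
  have "\<exists>x. (x, k) \<in> R" if "k \<in> K" for k using that K(1) R_snd by force
  then obtain \<xi> where \<xi>: "\<And>k. k \<in> K \<Longrightarrow> (\<xi> k, k) \<in> R" by metis
  define \<phi> where "\<phi> k y = max 0 (\<epsilon> / 2 - dist y k)" for k y :: "real ^ 'b"
  \<comment> \<open>the tent functions \<open>\<phi> k\<close> are left unnormalized, as only the vanishing of g matters\<close>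
  define g where "g y = (\<Sum>k\<in>K. \<phi> k y *\<^sub>R \<xi> k) - (\<Sum>k\<in>K. \<phi> k (- y) *\<^sub>R \<xi> k)" for y
  have "continuous_on (sphere 0 1) g"
    unfolding g_def \<phi>_def by (intro continuous_intros)
  then obtain y where y: "y \<in> sphere 0 1" "g y = 0"
    using Borsuk_Ulam_vec[OF card, of g] by (auto simp: g_def)
  \<comment> \<open>the second summand of g averages the points \<open>- \<xi> k\<close>, which correspond to \<open>- k\<close>\<close>
  define u where "u = case_sum (\<lambda>k. \<phi> k y) (\<lambda>k. \<phi> k (- y))"
  define x where "x = case_sum \<xi> (\<lambda>k. - \<xi> k)"
  obtain k where k: "k \<in> K" "y \<in> ball k (\<epsilon> / 2)" using y(1) K(3) by auto
  have "0 \<in> convex hull F y"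
  proof (rule zero_in_convex_if_conic_zero[of _ "K <+> K" u x "Inl k"])
    fix i assume i: "i \<in> K <+> K" "u i \<noteq> 0"
    show "x i \<in> convex hull F y"
    proof (rule hull_inc, cases i)
      case (Inl k)
      then show "x i \<in> F y" using i \<xi>[of k] by (auto simp: u_def x_def F_def \<phi>_def max_def split: if_splits)
    next
      case (Inr k)
      then have "dist (- y) k < \<epsilon> / 2" "k \<in> K" using i by (auto simp: u_def \<phi>_def max_def split: if_splits)
      moreover have "dist (- y) k = dist y (- k)" by (metis dist_minus minus_minus)
      ultimately show "x i \<in> F y" using R_minus[OF \<xi>[of k]] Inr by (auto simp: x_def F_def)
    qed
  next
    show "(\<Sum>i\<in>K <+> K. u i *\<^sub>R x i) = 0"
      using y(2) K(2) by (simp add: sum.Plus u_def x_def g_def sum_negf)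
  qed (use k K(2) in \<open>auto simp: u_def \<phi>_def dist_commute split: sum.splits\<close>)
  then show False using F by blast
qed

theorem theorem10:
  fixes m n :: nat
  assumes "0 < m" and "m < n"
    and "CARD('a::finite) = m + 1" and "CARD('b::finite) = n + 1"
  shows "Z2_GH_dist (sphere (0 :: real ^ 'a) 1) uminus (sphere (0 :: real ^ 'b) 1) uminus
           \<ge> ennreal (1 / 2 * sqrt ((2 * real m + 4) / (real m + 1)))"
proof -
  let ?E = "sqrt ((2 * real m + 4) / (real m + 1))"
  have E: "(2 * real m + 4) / (real m + 1) = 2 + 2 / CARD('a)" by (simp add: assms(3) field_simps)
  have "ennreal ?E \<le> distortion R"
    if R: "Z2_correspondence (sphere (0 :: real ^ 'a) 1) uminus (sphere (0 :: real ^ 'b) 1) uminus R" for R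
  proof (rule ennreal_le_epsilon)
    fix \<epsilon> :: real assume "0 < \<epsilon>"
    moreover have "CARD('a) < CARD('b)" using assms by simp
    ultimately obtain x y x' y' where p: "(x, y) \<in> R" "(x', y') \<in> R" "dist y y' < \<epsilon>"
      and wide: "2 + 2 / CARD('a) \<le> (dist x x')\<^sup>2"
      using Z2_correspondence_discontinuity[OF _ R] by blast
    have "?E \<le> dist x x'" unfolding E using wide by (intro real_le_lsqrt) auto
    then have "ennreal ?E \<le> ennreal (\<bar>dist x x' - dist y y'\<bar> + \<epsilon>)"
      using p(3) by (intro ennreal_leI) linarith
    also have "\<dots> = ennreal \<bar>dist x x' - dist y y'\<bar> + ennreal \<epsilon>"
      using \<open>0 < \<epsilon>\<close> by (intro ennreal_plus) auto
    also have "ennreal \<bar>dist x x' - dist y y'\<bar> \<le> distortion R"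
      unfolding distortion_def by (rule SUP_upper2[OF p(1)]) (auto intro: SUP_upper2[OF p(2)])
    finally show "ennreal ?E \<le> distortion R + ennreal \<epsilon>" by (simp add: add_right_mono)
  qed
  then have "ennreal ?E \<le> (INF R\<in>{R. Z2_correspondence (sphere (0 :: real ^ 'a) 1) uminus
      (sphere (0 :: real ^ 'b) 1) uminus R}. distortion R)"
    by (intro INF_greatest) auto
  then have "ennreal ?E / 2 \<le> Z2_GH_dist (sphere (0 :: real ^ 'a) 1) uminus (sphere (0 :: real ^ 'b) 1) uminus"
    unfolding Z2_GH_dist_def by (rule divide_right_mono_ennreal)
  moreover have "ennreal (1 / 2 * ?E) = ennreal ?E / 2"
    by (simp add: ennreal_divide_numeral flip: mult.commute)
  ultimately show ?thesis by simp
qed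

end
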